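(* There is an absolute constant $C>0$ such that for every integrable function $f:[0,1]\to\mathbb{R}$, every sequence $\mathbf{x}=\{x_n\}_{n=1}^\infty\subset[0,1]$ and every $N\in\mathbb{N}$ there holds $$\mathcal{E}_N(f;\mathbf{x})\le C\,D_N^*(\mathbf{x})\,\nu(f;N).$$
   Context: Here $\mathbb{N}=\{1,2,3,\dots\}$. For a sequence $\mathbf{x}=\{x_n\}_{n=1}^\infty\subset[0,1]$ and $f:[0,1]\to\mathbb{R}$, the quadrature error is $$\mathcal{E}_N(f;\mathbf{x})=\left|\frac1N\sum_{n=1}^N f(x_n)-\int_0^1 f(t)\,dt\right|.$$ For $E\subset[0,1]$ let $A_N(E,\mathbf{x})=\sum_{n=1}^N\chi_E(x_n)$, where $\chi_E$ is the indicator function of $E$ (the number of indices $1\le n\le N$ with $x_n\in E$). The star discrepancy is $$D_N^*(\mathbf{x})=\sup_{0<b\le1}\left|\frac{A_N([0,b),\mathbf{x})}{N}-b\right|.$$ For an interval $I=[a,b]\subset[0,1]$ write $f(I)=f(b)-f(a)$. The modulus of variation of $f$ is $$\nu(f;N)=\sup\sum_j|f(I_j)|\in[0,\infty],$$ where the supremum is taken over all collections of at most $N$ non-overlapping subintervals $I_j$ of $[0,1]$ (non-overlapping: disjoint interiors). It may equal $+\infty$ if $f$ is unbounded, in which case the right-hand side is understood as $+\infty$. *)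

theory Defs
  imports "HOL-Analysis.Analysis"
begin

text \<open>
  Sequences are indexed from 1; the value \<open>x 0\<close> is never used. A function on the unit interval
  is a total function \<open>real \<Rightarrow> real\<close> whose values outside \<open>{0..1}\<close> are never used.
\<close>

definition quadrature_error :: "nat \<Rightarrow> (real \<Rightarrow> real) \<Rightarrow> (nat \<Rightarrow> real) \<Rightarrow> real"
  where "quadrature_error N f x =
    \<bar>(1 / real N) * (\<Sum>n=1..N. f (x n)) - (LINT t:{0..1}|lebesgue. f t)\<bar>"

definition counting :: "nat \<Rightarrow> real set \<Rightarrow> (nat \<Rightarrow> real) \<Rightarrow> real"
  where "counting N E x = (\<Sum>n=1..N. indicator E (x n))"

text \<open>The supremum below is over a nonempty set of reals which is bounded above by 1.\<close>

definition star_discrepancy :: "nat \<Rightarrow> (nat \<Rightarrow> real) \<Rightarrow> real"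
  where "star_discrepancy N x = (SUP b\<in>{0<..1}. \<bar>counting N {0..<b} x / real N - b\<bar>)"

text \<open>
  For a nonempty interval \<open>I = {a..b}\<close> this is \<open>f b - f a\<close>.
\<close>

definition increment :: "(real \<Rightarrow> real) \<Rightarrow> real set \<Rightarrow> real"
  where "increment f I = f (Sup I) - f (Inf I)"

text \<open>
  \<open>D division_of \<Union>D\<close> says that \<open>D\<close> is a finite set of nonempty compact intervals with pairwise
  disjoint interiors. Degenerate intervals are allowed, but their increment is 0.
\<close>

definition nonoverlapping_collections :: "nat \<Rightarrow> real set set set"
  where "nonoverlapping_collections N = {D. D division_of \<Union>D \<and> \<Union>D \<subseteq> {0..1} \<and> card D \<le> N}"

definition modulus_of_variation :: "(real \<Rightarrow> real) \<Rightarrow> nat \<Rightarrow> ereal"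
  where "modulus_of_variation f N =
    (SUP D\<in>nonoverlapping_collections N. ereal (\<Sum>I\<in>D. \<bar>increment f I\<bar>))"

end

theory Submission
  imports Defs
begin

text \<open>
  Let \<open>D\<close> be the star discrepancy and \<open>y\<^sub>0 \<le> \<dots> \<le> y\<^sub>N\<^sub>-\<^sub>1\<close> the sorted points. Counting the points below \<open>y\<^sub>k\<close>
  gives \<open>(k + 1) / N - D \<le> y\<^sub>k \<le> k / N + D\<close>, and in particular \<open>D \<ge> 1 / (2 N)\<close>. Choosing
  \<open>t\<^sub>k \<in> [k / N, (k + 1) / N]\<close> with \<open>f t\<^sub>k\<close> at least the mean of \<open>f\<close> there bounds the integral by
  the average of the \<open>f t\<^sub>k\<close>. The interval between \<open>y\<^sub>k\<close> and \<open>t\<^sub>k\<close> lies in \<open>[k / N - D, (k + 1) / N + D]\<close>,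
  so for \<open>m \<ge> 2 N D + 1\<close> the intervals with \<open>k\<close> in one residue class modulo \<open>m\<close> do not overlap, and the
  sum of all \<open>\<bar>f y\<^sub>k - f t\<^sub>k\<bar>\<close> is at most \<open>m\<close> times the modulus of variation. One may take \<open>m \<le> 6 N D\<close>.
  The reverse inequality is the same statement for \<open>- f\<close>.
\<close>

section \<open>Sums of increments and the modulus of variation\<close>

lemma sum_increments_le_modulus_of_variation:
  fixes a b :: "nat \<Rightarrow> real"
  assumes "finite K" "card K \<le> N"
    and unit: "\<And>k. k \<in> K \<Longrightarrow> a k \<in> {0..1} \<and> b k \<in> {0..1}"
    and sep: "\<And>j k. j \<in> K \<Longrightarrow> k \<in> K \<Longrightarrow> j < k \<Longrightarrow> max (a j) (b j) \<le> min (a k) (b k)"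
  shows "ereal (\<Sum>k\<in>K. \<bar>f (a k) - f (b k)\<bar>) \<le> modulus_of_variation f N"
proof -
  define J where "J k = {min (a k) (b k)..max (a k) (b k)}" for k
  \<comment> \<open>Degenerate pairs contribute 0, but several of them could give the same one-point
    set \<open>J k\<close>. Once they are dropped, all interiors are nonempty, so their disjointness
    makes \<open>J\<close> injective and the sum over the set of intervals becomes a sum over
    indices.\<close>
  define L where "L = {k \<in> K. a k \<noteq> b k}"
  have fin: "finite L" and "L \<subseteq> K"
    using \<open>finite K\<close> by (auto simp: L_def)
  have interior_J: "interior (J k) = {min (a k) (b k)<..<max (a k) (b k)}" for k
    by (simp add: J_def)
  have disj: "interior (J j) \<inter> interior (J k) = {}" if "j \<in> L" "k \<in> L" "j \<noteq> k" for j k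
  proof (cases "j < k")
    case True
    then show ?thesis
      using sep[of j k] that \<open>L \<subseteq> K\<close> unfolding interior_J by fastforce
  next
    case False
    then show ?thesis
      using sep[of k j] that \<open>L \<subseteq> K\<close> unfolding interior_J by fastforce
  qed
  have ne: "interior (J k) \<noteq> {}" if "k \<in> L" for k
    using that unfolding interior_J L_def by auto
  have inj: "inj_on J L"
    using disj ne by (metis inf.idem inj_onI)
  have "J ` L division_of \<Union>(J ` L)"
  proof (rule division_ofI)
    show "\<exists>a b. I = cbox a b" if "I \<in> J ` L" for I
      using that unfolding J_def box_real by blast
    show "I \<noteq> {}" if "I \<in> J ` L" for I
      using that ne by force
    show "interior I \<inter> interior I' = {}" if "I \<in> J ` L" "I' \<in> J ` L" "I \<noteq> I'" for I I'
      using that disj by (metis imageE)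
  qed (use fin in auto)
  moreover have "\<Union>(J ` L) \<subseteq> {0..1}"
    using unit \<open>L \<subseteq> K\<close> unfolding J_def by fastforce
  moreover have "card (J ` L) \<le> N"
    using card_image_le[OF fin, of J] card_mono[OF \<open>finite K\<close> \<open>L \<subseteq> K\<close>] \<open>card K \<le> N\<close> by linarith
  ultimately have "J ` L \<in> nonoverlapping_collections N"
    by (simp add: nonoverlapping_collections_def)
  then have "ereal (\<Sum>I\<in>J ` L. \<bar>increment f I\<bar>) \<le> modulus_of_variation f N"
    unfolding modulus_of_variation_def by (rule SUP_upper)
  also have "(\<Sum>I\<in>J ` L. \<bar>increment f I\<bar>) = (\<Sum>k\<in>L. \<bar>f (a k) - f (b k)\<bar>)"
    unfolding sum.reindex[OF inj]
    by (rule sum.cong) (auto simp: J_def increment_def min_def max_def abs_minus_commute)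
  also have "\<dots> = (\<Sum>k\<in>K. \<bar>f (a k) - f (b k)\<bar>)"
    using \<open>finite K\<close> by (intro sum.mono_neutral_left) (auto simp: L_def)
  finally show ?thesis .
qed

lemma modulus_of_variation_uminus:
  "modulus_of_variation (\<lambda>t. - f t) N = modulus_of_variation f N"
  unfolding modulus_of_variation_def increment_def by (simp add: abs_minus_commute)

section \<open>Star discrepancy and the sorted points\<close>

lemma counting_eq_card: "counting N E x = real (card {n\<in>{1..N}. x n \<in> E})"
  unfolding counting_def by (simp add: indicator_def if_distrib sum.If_cases Int_def)

lemma star_discrepancy_upper:
  assumes "0 < b" "b \<le> 1"
  shows "\<bar>counting N {0..<b} x / real N - b\<bar> \<le> star_discrepancy N x"
  unfolding star_discrepancy_def
proof (rule cSUP_upper)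
  show "b \<in> {0<..1}"
    using assms by simp
  show "bdd_above ((\<lambda>b. \<bar>counting N {0..<b} x / real N - b\<bar>) ` {0<..1})"
  proof (rule bdd_aboveI2)
    fix b :: real
    assume b: "b \<in> {0<..1}"
    have "card {n\<in>{1..N}. x n \<in> {0..<b}} \<le> card {1..N}"
      by (rule card_mono) auto
    then have "0 \<le> counting N {0..<b} x / real N" "counting N {0..<b} x / real N \<le> 1"
      by (auto simp: counting_eq_card divide_le_eq_1)
    then show "\<bar>counting N {0..<b} x / real N - b\<bar> \<le> 1"
      using b by auto
  qed
qed

text \<open>Sorting preserves the multiset of values, so repeated points are counted once per
  position on both sides.\<close>

lemma counting_eq_card_nth_sort:
  "counting N E x =
    real (card {i. i < N \<and> sort (map x [1..<Suc N]) ! i \<in> E})"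
proof -
  have "card {n\<in>{1..N}. x n \<in> E} = length (filter (\<lambda>y. y \<in> E) (map x [1..<Suc N]))"
    by (simp add: filter_map flip: distinct_card) (rule arg_cong[where f = card], auto)
  also have "\<dots> = size (filter_mset (\<lambda>y. y \<in> E) (mset (sort (map x [1..<Suc N]))))"
    by (metis mset_filter mset_sort size_mset)
  also have "\<dots> = card {i. i < N \<and> sort (map x [1..<Suc N]) ! i \<in> E}"
    by (simp add: length_filter_conv_card flip: mset_filter del: mset_sort upt_Suc)
  finally show ?thesis
    by (simp add: counting_eq_card)
qed

text \<open>The sorted points are indexed from 0, so that exactly \<open>k\<close> positions precede
  \<open>y k\<close>.\<close>

context
  fixes N :: nat and x y :: "nat \<Rightarrow> real"
  assumes N: "N \<ge> 1"
    and x: "\<And>n. n \<ge> 1 \<Longrightarrow> x n \<in> {0..1}"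
  defines "y \<equiv> \<lambda>k. sort (map x [1..<Suc N]) ! k"
begin

lemma order_statistic_mono: "i \<le> j \<Longrightarrow> j < N \<Longrightarrow> y i \<le> y j"
  unfolding y_def by (rule sorted_nth_mono) auto

lemma order_statistic_unit: "k < N \<Longrightarrow> y k \<in> {0..1}"
proof -
  assume "k < N"
  then have "y k \<in> set (sort (map x [1..<Suc N]))"
    unfolding y_def by (intro nth_mem) simp
  then show ?thesis
    using x by auto
qed

lemma sum_order_statistic: "(\<Sum>k<N. f (y k)) = (\<Sum>n=1..N. f (x n))"
proof -
  have "(\<Sum>k<N. f (y k)) = sum_list (map f (sort (map x [1..<Suc N])))"
    unfolding y_def by (simp add: sum_list_sum_nth atLeast0LessThan del: upt_Suc)
  also have "\<dots> = sum_list (map f (map x [1..<Suc N]))"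
    by (metis mset_map mset_sort sum_mset_sum_list)
  also have "\<dots> = (\<Sum>n=1..N. f (x n))"
    by (simp add: interv_sum_list_conv_sum_set_nat atLeastLessThanSuc_atLeastAtMost del: upt_Suc)
  finally show ?thesis .
qed

lemma star_discrepancy_nonneg: "0 \<le> star_discrepancy N x"
  using star_discrepancy_upper[of 1 N x] by linarith

lemma order_statistic_le:
  assumes "k < N"
  shows "y k \<le> k / N + star_discrepancy N x"
\<comment> \<open>The test value is \<open>b = y k\<close>; it is admissible in the supremum only if
  it is positive.\<close>
proof (cases "y k = 0")
  case True
  then show ?thesis
    using star_discrepancy_nonneg by simp
next
  case False
  have "i < k" if "i < N" "y i < y k" for i
    using order_statistic_mono[of k i] that by force
  then have "{i. i < N \<and> y i \<in> {0..<y k}} \<subseteq> {..<k}"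
    by auto
  then have "counting N {0..<y k} x \<le> k"
    unfolding counting_eq_card_nth_sort y_def[symmetric]
    using card_mono[of "{..<k}"] by fastforce
  then have "counting N {0..<y k} x / N \<le> k / N"
    by (simp add: divide_right_mono)
  then show ?thesis
    using star_discrepancy_upper[of "y k" N x] order_statistic_unit[OF assms] False by fastforce
qed

text \<open>The half-open interval \<open>{0..<y k}\<close> misses \<open>y k\<close> itself, so the
  test value is some \<open>b\<close> slightly above \<open>y k\<close>, and then \<open>b\<close>
  decreases to \<open>y k\<close>. This needs room below 1; for \<open>y k = 1\<close> the bound is
  immediate.\<close>

lemma order_statistic_ge:
  assumes "k < N"
  shows "(real k + 1) / N - star_discrepancy N x \<le> y k"
proof (cases "y k = 1")
  case True
  moreover have "(real k + 1) / N \<le> 1"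
    using assms by (simp add: divide_le_eq_1)
  ultimately show ?thesis
    using star_discrepancy_nonneg by linarith
next
  case False
  then have "y k < 1"
    using order_statistic_unit[OF assms] by auto
  then show ?thesis
  proof (rule dense_ge_bounded)
    fix b
    assume b: "y k < b" "b < 1"
    have "y i \<in> {0..<b}" if "i \<le> k" for i
      using order_statistic_mono[OF that assms] order_statistic_unit[of i] that assms b by auto
    then have "{..k} \<subseteq> {i. i < N \<and> y i \<in> {0..<b}}"
      using assms by auto
    then have "counting N {0..<b} x \<ge> real k + 1"
      unfolding counting_eq_card_nth_sort y_def[symmetric]
      using card_mono[of "{i. i < N \<and> y i \<in> {0..<b}}" "{..k}"] by fastforce
    then have "counting N {0..<b} x / N \<ge> (real k + 1) / N"
      by (simp add: divide_right_mono)
    then show "(real k + 1) / N - star_discrepancy N x \<le> b"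
      using star_discrepancy_upper[of b N x] order_statistic_unit[OF assms] b by fastforce
  qed
qed

text \<open>The two bounds on the smallest point \<open>y 0\<close> must be compatible. This lets
  additive constants from rounding be absorbed into multiples of \<open>N * D\<close>.\<close>

lemma star_discrepancy_ge: "1 \<le> 2 * N * star_discrepancy N x"
proof -
  have "1 / N \<le> 2 * star_discrepancy N x"
    using order_statistic_le[of 0] order_statistic_ge[of 0] N by simp
  then show ?thesis
    using N by (simp add: field_simps)
qed

lemma star_discrepancy_pos: "0 < star_discrepancy N x"
  using star_discrepancy_ge star_discrepancy_nonneg by (cases "star_discrepancy N x = 0") auto

section \<open>Comparison with one point from each cell\<close>

lemma quadrature_sum_diff_le:
  assumes v: "modulus_of_variation f N = ereal v"
    and t: "\<And>k. k < N \<Longrightarrow> t k \<in> {k / N..(real k + 1) / N}"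
  shows "\<bar>(\<Sum>n=1..N. f (x n)) - (\<Sum>k<N. f (t k))\<bar> \<le> 6 * N * star_discrepancy N x * v"
proof -
  define D where "D = star_discrepancy N x"
  define m where "m = nat \<lceil>2 * N * D\<rceil> + 1"
  have D: "1 \<le> 2 * N * D"
    using star_discrepancy_ge by (simp add: D_def)
  \<comment> \<open>The constant 6 arises here: \<open>m\<close> is less than
    \<open>2 * N * D + 2\<close>, and 2 is at most \<open>4 * N * D\<close>.\<close>
  then have m: "2 * N * D \<le> real m - 1" "real m \<le> 6 * N * D"
    unfolding m_def by linarith+
  have unit: "t k \<in> {0..1}" if "k < N" for k
  proof -
    have "0 \<le> k / N" "(real k + 1) / N \<le> 1"
      using that by (auto simp: divide_le_eq_1)
    then show ?thesis
      using t[OF that] unfolding atLeastAtMost_iff by linarith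
  qed
  have lower: "k / N - D \<le> min (y k) (t k)" if "k < N" for k
  proof -
    have "k / N \<le> (real k + 1) / N"
      by (simp add: divide_right_mono)
    then show ?thesis
      using order_statistic_ge[OF that] t[OF that] star_discrepancy_nonneg by (auto simp: D_def)
  qed
  have upper: "max (y k) (t k) \<le> (real k + 1) / N + D" if "k < N" for k
  proof -
    have "k / N \<le> (real k + 1) / N"
      by (simp add: divide_right_mono)
    then show ?thesis
      using order_statistic_le[OF that] t[OF that] star_discrepancy_nonneg by (auto simp: D_def)
  qed
  have sep: "max (y j) (t j) \<le> min (y k) (t k)"
    if "j < N" "k < N" "j < k" "j mod m = k mod m" for j k
  proof -
    \<comment> \<open>Distinct indices in one class differ by at least \<open>m\<close>, hence
      \<open>j + 1 + 2 * N * D\<close> is at most \<open>k\<close>. After division by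
      \<open>N\<close>, this leaves room for an error \<open>D\<close> at the right end of the
      earlier interval and at the left end of the later one.\<close>
    have "j + m \<le> k"
      using that by (metis add_le_cancel_left le_add_diff_inverse less_imp_le_nat
          mod_eq_dvd_iff_nat dvd_imp_le zero_less_diff)
    then have "real j + real m \<le> real k"
      by linarith
    then have "(real j + 1 + 2 * N * D) / N \<le> k / N"
      using m by (intro divide_right_mono) auto
    then have "(real j + 1) / N + D \<le> k / N - D"
      using N by (simp add: add_divide_distrib)
    then show ?thesis
      using upper[of j] lower[of k] that by linarith
  qed
  have "\<bar>(\<Sum>n=1..N. f (x n)) - (\<Sum>k<N. f (t k))\<bar> = \<bar>\<Sum>k<N. f (y k) - f (t k)\<bar>"
    by (simp add: sum_subtractf sum_order_statistic)
  also have "\<dots> \<le> (\<Sum>k<N. \<bar>f (y k) - f (t k)\<bar>)"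
    by (rule sum_abs)
  also have "\<dots> = (\<Sum>r<m. \<Sum>k\<in>{k\<in>{..<N}. k mod m = r}. \<bar>f (y k) - f (t k)\<bar>)"
    by (rule sum.group[symmetric]) (auto simp: m_def)
  also have "\<dots> \<le> (\<Sum>r<m. v)"
  proof (rule sum_mono)
    fix r
    have "card {k\<in>{..<N}. k mod m = r} \<le> N"
      using card_mono[of "{..<N}" "{k\<in>{..<N}. k mod m = r}"] by auto
    then show "(\<Sum>k\<in>{k\<in>{..<N}. k mod m = r}. \<bar>f (y k) - f (t k)\<bar>) \<le> v"
      using sum_increments_le_modulus_of_variation[of "{k\<in>{..<N}. k mod m = r}" N y t f]
        unit order_statistic_unit sep v by auto
  qed
  also have "\<dots> = m * v"
    by simp
  also have "\<dots> \<le> 6 * N * D * v"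
  proof (rule mult_right_mono[OF m(2)])
    show "0 \<le> v"
      using sum_increments_le_modulus_of_variation[of "{}" N y t f] v by simp
  qed
  finally show ?thesis
    by (simp add: D_def)
qed

end

section \<open>Bounding the integral by a sum of values\<close>

text \<open>Continuity is not assumed. If \<open>f\<close> stayed below its mean, then the mean
  minus \<open>f\<close> would be strictly positive on an interval of positive measure and yet have
  integral 0.\<close>

lemma exists_ge_mean:
  fixes f :: "real \<Rightarrow> real"
  assumes f: "f integrable_on {a..b}" and "a < b"
  shows "\<exists>t\<in>{a..b}. integral {a..b} f \<le> (b - a) * f t"
proof (rule ccontr)
  define g where "g t = integral {a..b} f / (b - a) - f t" for t
  assume "\<not> ?thesis"
  then have pos: "0 < g t" if "t \<in> {a..b}" for t
    using that \<open>a < b\<close> by (force simp: g_def field_simps)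
  have g: "g integrable_on {a..b}"
    unfolding g_def by (intro integrable_diff f integrable_const_ivl)
  \<comment> \<open>Positivity of \<open>g\<close> upgrades Henstock-Kurzweil integrability to
    Lebesgue integrability, for which strict monotonicity of the integral is used.\<close>
  have int: "integrable (lebesgue_on {a..b}) g"
    using g pos
    by (intro absolutely_integrable_imp_integrable nonnegative_absolutely_integrable_1)
      (auto intro: less_imp_le)
  interpret finite_measure "lebesgue_on {a..b}"
    by (intro finite_measure_lebesgue_on) simp
  have "integral\<^sup>L (lebesgue_on {a..b}) (\<lambda>_. 0) < integral\<^sup>L (lebesgue_on {a..b}) g"
    using int pos \<open>a < b\<close>
    by (intro integral_less_AE_space) (auto simp: emeasure_restrict_space intro!: AE_I2)
  also have "\<dots> = integral {a..b} g"
    by (intro lebesgue_integral_eq_integral int) simp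
  also have "\<dots> = 0"
    unfolding g_def using \<open>a < b\<close>
    by (simp add: Henstock_Kurzweil_Integration.integral_diff[OF integrable_const_ivl f])
  finally show False
    by simp
qed

lemma integral_equal_pieces:
  fixes f :: "real \<Rightarrow> real" and k N :: nat
  assumes f: "f integrable_on {0..1}" and "k \<le> N"
  shows "integral {0..k / N} f = (\<Sum>j<k. integral {j / N..(real j + 1) / N} f)"
  using \<open>k \<le> N\<close>
proof (induction k)
  case (Suc k)
  have "f integrable_on {0..(real k + 1) / N}"
    using f Suc.prems by (intro integrable_subinterval_real[OF f]) auto
  then have "integral {0..(real k + 1) / N} f = integral {0..k / N} f + integral {k / N..(real k + 1) / N} f"
    by (intro Henstock_Kurzweil_Integration.integral_combine[symmetric])
      (auto simp: divide_right_mono)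
  then show ?case
    using Suc by (simp add: add.commute)
qed simp

lemma integral_le_sum:
  fixes f :: "real \<Rightarrow> real" and N :: nat
  assumes f: "f integrable_on {0..1}" and N: "N \<ge> 1"
  shows "\<exists>t :: nat \<Rightarrow> real. (\<forall>k<N. t k \<in> {k / N..(real k + 1) / N}) \<and> N * integral {0..1} f \<le> (\<Sum>k<N. f (t k))"
proof -
  have "\<exists>t\<in>{k / N..(real k + 1) / N}. integral {k / N..(real k + 1) / N} f \<le> 1 / N * f t" if "k < N" for k :: nat
  proof -
    have "k / N < (real k + 1) / N" "(real k + 1) / N - k / N = 1 / N" "(real k + 1) / N \<le> 1"
      using N that by (auto simp: field_simps)
    moreover have "f integrable_on {k / N..(real k + 1) / N}"
      using calculation by (intro integrable_subinterval_real[OF f]) auto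
    ultimately show ?thesis
      using exists_ge_mean[of f "k / N" "(real k + 1) / N"] by simp
  qed
  then obtain t where t: "\<And>k. k < N \<Longrightarrow> t k \<in> {k / N..(real k + 1) / N}"
    "\<And>k. k < N \<Longrightarrow> integral {k / N..(real k + 1) / N} f \<le> 1 / N * f (t k)"
    by metis
  have "integral {0..1} f = (\<Sum>k<N. integral {k / N..(real k + 1) / N} f)"
    using integral_equal_pieces[OF f, of N N] N by simp
  also have "\<dots> \<le> (\<Sum>k<N. 1 / N * f (t k))"
    by (intro sum_mono t(2)) auto
  finally have "integral {0..1} f \<le> 1 / N * (\<Sum>k<N. f (t k))"
    by (simp add: sum_distrib_left)
  then show ?thesis
    using t(1) N by (intro exI[of _ t]) (auto simp: field_simps)
qed

lemma integral_minus_sum_le: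
  fixes f :: "real \<Rightarrow> real"
  assumes f: "f integrable_on {0..1}" and N: "N \<ge> 1"
    and x: "\<And>n. n \<ge> 1 \<Longrightarrow> x n \<in> {0..1}"
    and v: "modulus_of_variation f N = ereal v"
  shows "integral {0..1} f - 1 / N * (\<Sum>n=1..N. f (x n)) \<le> 6 * star_discrepancy N x * v"
proof -
  obtain t where t: "\<And>k. k < N \<Longrightarrow> t k \<in> {k / N..(real k + 1) / N}"
    and "N * integral {0..1} f \<le> (\<Sum>k<N. f (t k))"
    using integral_le_sum[OF f N] by blast
  moreover have "\<bar>(\<Sum>n=1..N. f (x n)) - (\<Sum>k<N. f (t k))\<bar> \<le> 6 * N * star_discrepancy N x * v"
    by (rule quadrature_sum_diff_le) (use N x v t in auto)
  ultimately have "N * integral {0..1} f - (\<Sum>n=1..N. f (x n)) \<le> 6 * N * star_discrepancy N x * v"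
    by linarith
  then show ?thesis
    using N by (simp add: field_simps)
qed

theorem theorem1p1:
  shows "\<exists>C::real. C > 0 \<and>
    (\<forall>(f :: real \<Rightarrow> real) (x :: nat \<Rightarrow> real) (N :: nat).
      set_integrable lebesgue {0..1} f \<longrightarrow>
      (\<forall>n\<ge>1. x n \<in> {0..1}) \<longrightarrow>
      N \<ge> 1 \<longrightarrow>
      ereal (quadrature_error N f x)
        \<le> ereal (C * star_discrepancy N x) * modulus_of_variation f N)"
proof (intro exI[of _ 6] conjI allI impI)
  fix f :: "real \<Rightarrow> real" and x :: "nat \<Rightarrow> real" and N :: nat
  assume f: "set_integrable lebesgue {0..1} f" and "\<forall>n\<ge>1. x n \<in> {0..1}" and N: "N \<ge> 1"
  then have x: "\<And>n. n \<ge> 1 \<Longrightarrow> x n \<in> {0..1}"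
    by blast
  note hk = set_lebesgue_integral_eq_integral[OF f]
  \<comment> \<open>Strict positivity settles the case of infinite modulus: in \<open>ereal\<close>,
    0 times infinity would be 0.\<close>
  have pos: "star_discrepancy N x > 0"
    by (rule star_discrepancy_pos) (use N x in auto)
  show "ereal (quadrature_error N f x) \<le> ereal (6 * star_discrepancy N x) * modulus_of_variation f N"
  proof (cases "modulus_of_variation f N")
    case (real v)
    have "integral {0..1} f - 1 / N * (\<Sum>n=1..N. f (x n)) \<le> 6 * star_discrepancy N x * v"
      by (rule integral_minus_sum_le) (use hk(1) N x real in auto)
    \<comment> \<open>Passing to \<open>- f\<close> reverses the sign of the error and keeps the
      modulus of variation.\<close>
    moreover have "1 / N * (\<Sum>n=1..N. f (x n)) - integral {0..1} f \<le> 6 * star_discrepancy N x * v"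
      using integral_minus_sum_le[of "\<lambda>t. - f t" N x v] hk(1) N x real
      by (simp add: modulus_of_variation_uminus integrable_neg sum_negf)
    ultimately show ?thesis
      unfolding quadrature_error_def hk(2) real by (simp add: abs_le_iff)
  next
    case PInf
    then show ?thesis
      using pos by simp
  next
    case MInf
    \<comment> \<open>The empty family has sum 0, so the modulus cannot be minus infinity.\<close>
    then show ?thesis
      using sum_increments_le_modulus_of_variation[of "{}" N x x f] by simp
  qed
qed simp

end
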